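(* Let $\Bbbk$ be a field of characteristic zero, $R=\Bbbk[x_1,\ldots,x_n]$, $\mathfrak m=(x_1,\ldots,x_n)$, and let $J\subseteq R$ be an ideal. Then the following statements hold: (i) If $M\subseteq R$ is an $\mathfrak m$-primary ideal, then $$J\star M=\{f\in R\mid\delta\cdot f\in J\text{ for all }\delta\in\mathfrak A(M)\}.$$ (ii) If $V\subseteq\Bbbk[\partial_{x_1},\ldots,\partial_{x_n}]$ is a finite dimensional $\Bbbk$-subspace closed under the bracket operation, then $$\{f\in R\mid\delta\cdot f\in J\text{ for all }\delta\in V\}=J\star\mathfrak B(V).$$
   Context: Join: for ideals $J,K\subseteq R$, $$J\star K=\Big(J(\mathbf v)+K(\mathbf w)+(x_i-v_i-w_i\mid1\le i\le n)\Big)\cap R,$$ where the sum is an ideal in $\Bbbk[x_1,\ldots,x_n,v_1,\ldots,v_n,w_1,\ldots,w_n]$, $J(\mathbf v)\subseteq\Bbbk[v_1,\ldots,v_n]$ is $J$ with $v_i$ substituted for $x_i$, and $K(\mathbf w)\subseteq\Bbbk[w_1,\ldots,w_n]$ is $K$ with $w_i$ substituted for $x_i$. Let $R$ act on $\Bbbk[z_1,\ldots,z_n]$ with $x_i$ acting as $\partial/\partial z_i$; write $f\cdot F$ for this action. For an $\mathfrak m$-primary ideal $M\subseteq R$, let $M^\perp=\{F\in\Bbbk[z_1,\ldots,z_n]\mid f\cdot F=0\text{ for all }f\in M\}$, and let $\mathfrak A(M)\subseteq\Bbbk[\partial_{x_1},\ldots,\partial_{x_n}]$ be the image of $M^\perp$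 under the $\Bbbk$-linear map $\mathbf z^\alpha\mapsto\partial_{\mathbf x}^\alpha$. A $\Bbbk$-subspace $V\subseteq\Bbbk[\partial_{x_1},\ldots,\partial_{x_n}]$ is closed under the bracket operation if $[\delta,x_i]\in V$ for all $\delta\in V$ and $1\le i\le n$, where $[\partial_{x_1}^{\alpha_1}\cdots\partial_{x_n}^{\alpha_n},x_i]=\alpha_i\,\partial_{x_1}^{\alpha_1}\cdots\partial_{x_i}^{\alpha_i-1}\cdots\partial_{x_n}^{\alpha_n}$. For such a finite dimensional $V$, let $W\subseteq\Bbbk[z_1,\ldots,z_n]$ be the image of $V$ under $\partial_{\mathbf x}^\alpha\mapsto\mathbf z^\alpha$, and $\mathfrak B(V)=W^\perp=\{f\in R\mid f\cdot F=0\text{ for all }F\in W\}$. For $\delta\in\Bbbk[\partial_{x_1},\ldots,\partial_{x_n}]$ and $f\in R$, $\delta\cdot f$ is the usual application of the constant coefficient differential operator $\delta$ to $f$. *)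

theory Defs
  imports Complex_Main "HOL-Library.Poly_Mapping"
begin

(* Polynomials with coefficients in 'k and one variable for each element of 'i.  The rings
   R = k[x_1,...,x_n], k[z_1,...,z_n] and k[d_{x_1},...,d_{x_n}] all have this type with 'i of
   cardinality n, so that the k-linear bijections z^a <-> d_x^a become the identity. *)
type_synonym ('i, 'k) mpoly = "('i \<Rightarrow>\<^sub>0 nat) \<Rightarrow>\<^sub>0 'k"

definition const :: "'k \<Rightarrow> ('i, 'k::comm_ring_1) mpoly" where
  "const c = Poly_Mapping.single 0 c"

definition var :: "'i \<Rightarrow> ('i, 'k::comm_ring_1) mpoly" where
  "var i = Poly_Mapping.single (Poly_Mapping.single i 1) 1"

definition smult :: "'k \<Rightarrow> ('i, 'k::comm_ring_1) mpoly \<Rightarrow> ('i, 'k) mpoly" where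
  "smult c F = const c * F"

definition subst ::
  "('i \<Rightarrow> ('j, 'k::comm_ring_1) mpoly) \<Rightarrow> ('i, 'k) mpoly \<Rightarrow> ('j, 'k) mpoly" where
  "subst \<sigma> f = (\<Sum>\<alpha>\<in>Poly_Mapping.keys f. const (Poly_Mapping.lookup f \<alpha>) *
     (\<Prod>i\<in>Poly_Mapping.keys \<alpha>. \<sigma> i ^ Poly_Mapping.lookup \<alpha> i))"

abbreviation is_ideal :: "'a::comm_ring_1 set \<Rightarrow> bool" where
  "is_ideal \<equiv> module.subspace (*)"

abbreviation ideal_gen :: "'a::comm_ring_1 set \<Rightarrow> 'a set" where
  "ideal_gen \<equiv> module.span (*)"

definition radical :: "'a::comm_ring_1 set \<Rightarrow> 'a set" where
  "radical I = {a. \<exists>k::nat. a ^ k \<in> I}"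

definition primary_ideal :: "'a::comm_ring_1 set \<Rightarrow> bool" where
  "primary_ideal I \<longleftrightarrow> is_ideal I \<and> I \<noteq> UNIV \<and>
     (\<forall>a b. a * b \<in> I \<longrightarrow> a \<in> I \<or> b \<in> radical I)"

definition max_ideal :: "('n, 'k::comm_ring_1) mpoly set" where
  "max_ideal = ideal_gen (range var)"

definition max_primary :: "('n, 'k::comm_ring_1) mpoly set \<Rightarrow> bool" where
  "max_primary M \<longleftrightarrow> primary_ideal M \<and> radical M = max_ideal"

definition finite_dim_subspace :: "('n, 'k::field) mpoly set \<Rightarrow> bool" where
  "finite_dim_subspace V \<longleftrightarrow>
     module.subspace smult V \<and> (\<exists>B. finite B \<and> V = module.span smult B)"

datatype 'n join_var = Xvar 'n | Vvar 'n | Wvar 'n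

(* The intersection with R is taken along the inclusion of R = k[x] into k[x,v,w]. *)
definition ideal_join ::
  "('n, 'k::comm_ring_1) mpoly set \<Rightarrow> ('n, 'k) mpoly set \<Rightarrow> ('n, 'k) mpoly set"
  (infixl \<open>\<star>\<close> 70) where
  "J \<star> K = {f. subst (\<lambda>i. var (Xvar i)) f \<in> ideal_gen
     (subst (\<lambda>i. var (Vvar i)) ` J \<union> subst (\<lambda>i. var (Wvar i)) ` K \<union>
      range (\<lambda>i. var (Xvar i) - var (Vvar i) - var (Wvar i)))}"

(* If i does not occur in \<alpha> then the exponent subtraction truncates, but the coefficient is 0. *)
definition partial_deriv :: "'i \<Rightarrow> ('i, 'k::comm_ring_1) mpoly \<Rightarrow> ('i, 'k) mpoly" where
  "partial_deriv i F = (\<Sum>\<alpha>\<in>Poly_Mapping.keys F.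
     Poly_Mapping.single (\<alpha> - Poly_Mapping.single i 1)
       (of_nat (Poly_Mapping.lookup \<alpha> i) * Poly_Mapping.lookup F \<alpha>))"

(* The order of composition in the fold is irrelevant: see partial_deriv_commute below. *)
definition mono_deriv :: "('i \<Rightarrow>\<^sub>0 nat) \<Rightarrow> ('i, 'k::comm_ring_1) mpoly \<Rightarrow> ('i, 'k) mpoly" where
  "mono_deriv \<alpha> F =
     Finite_Set.fold (\<lambda>i. partial_deriv i ^^ Poly_Mapping.lookup \<alpha> i) F (Poly_Mapping.keys \<alpha>)"

(* This is both the action f \<cdot> F of R on k[z] and the application \<delta> \<cdot> f of a
   constant coefficient differential operator \<delta> to f in R. *)
definition diff_action ::
  "('i, 'k::comm_ring_1) mpoly \<Rightarrow> ('i, 'k) mpoly \<Rightarrow> ('i, 'k) mpoly" (infixr \<open>\<cdot>\<close> 72) where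
  "f \<cdot> F = (\<Sum>\<alpha>\<in>Poly_Mapping.keys f. smult (Poly_Mapping.lookup f \<alpha>) (mono_deriv \<alpha> F))"

(* M^\<bottom> for M in R, respectively W^\<bottom> for W in k[z] *)
definition perp_ideal :: "('n, 'k::comm_ring_1) mpoly set \<Rightarrow> ('n, 'k) mpoly set" where
  "perp_ideal M = {F. \<forall>f\<in>M. f \<cdot> F = 0}"

definition perp_space :: "('n, 'k::comm_ring_1) mpoly set \<Rightarrow> ('n, 'k) mpoly set" where
  "perp_space W = {f. \<forall>F\<in>W. f \<cdot> F = 0}"

(* The maps z^a |-> d_x^a and d_x^a |-> z^a applied here are the identity: see type mpoly. *)
definition \<AA> :: "('n, 'k::comm_ring_1) mpoly set \<Rightarrow> ('n, 'k) mpoly set" where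
  "\<AA> M = perp_ideal M"

definition \<BB> :: "('n, 'k::comm_ring_1) mpoly set \<Rightarrow> ('n, 'k) mpoly set" where
  "\<BB> V = perp_space V"

(* [\<delta>, x_i] for \<delta> in k[d_{x_1},...,d_{x_n}] *)
definition bracket :: "('n, 'k::comm_ring_1) mpoly \<Rightarrow> 'n \<Rightarrow> ('n, 'k) mpoly" where
  "bracket \<delta> i = (\<Sum>\<alpha>\<in>Poly_Mapping.keys \<delta>. smult (Poly_Mapping.lookup \<delta> \<alpha>)
     (Poly_Mapping.single (\<alpha> - Poly_Mapping.single i 1) (of_nat (Poly_Mapping.lookup \<alpha> i))))"

definition bracket_closed :: "('n, 'k::comm_ring_1) mpoly set \<Rightarrow> bool" where
  "bracket_closed V \<longleftrightarrow> (\<forall>\<delta>\<in>V. \<forall>i. bracket \<delta> i \<in> V)"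

lemma module_times: "module ((*) :: 'a::comm_ring_1 \<Rightarrow> 'a \<Rightarrow> 'a)"
  by unfold_locales (simp_all add: algebra_simps)

lemma const_add: "const (a + b) = const a + const b"
  by (simp add: const_def single_add)

lemma const_mult: "const (a * b) = const a * const b"
  by (simp add: const_def mult_single)

lemma vector_space_smult: "vector_space (smult :: 'k::field \<Rightarrow> ('i, 'k) mpoly \<Rightarrow> _)"
  by unfold_locales (simp_all add: smult_def algebra_simps const_add const_mult,
      simp add: const_def)

lemma lookup_partial_deriv:
  fixes F :: "('i, 'k::comm_ring_1) mpoly"
  shows "Poly_Mapping.lookup (partial_deriv i F) \<beta> =
     of_nat (Poly_Mapping.lookup \<beta> i + 1) * Poly_Mapping.lookup F (\<beta> + Poly_Mapping.single i 1)"
proof -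
  let ?e = "Poly_Mapping.single i 1 :: 'i \<Rightarrow>\<^sub>0 nat"
  have shift: "\<alpha> = \<beta> + ?e" if "\<alpha> - ?e = \<beta>" "Poly_Mapping.lookup \<alpha> i \<noteq> 0" for \<alpha>
    using that by (auto intro!: poly_mapping_eqI simp: lookup_minus lookup_add lookup_single when_def)
  have "Poly_Mapping.lookup (partial_deriv i F) \<beta> = (\<Sum>\<alpha>\<in>Poly_Mapping.keys F.
     if \<alpha> = \<beta> + ?e then of_nat (Poly_Mapping.lookup \<alpha> i) * Poly_Mapping.lookup F \<alpha> else 0)"
    unfolding partial_deriv_def lookup_sum lookup_single
    by (intro sum.cong refl) (use shift in \<open>force simp: when_def\<close>)
  also have "\<dots> = of_nat (Poly_Mapping.lookup \<beta> i + 1) * Poly_Mapping.lookup F (\<beta> + ?e)"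
    by (simp add: lookup_add in_keys_iff)
  finally show ?thesis .
qed

lemma partial_deriv_commute: "partial_deriv i (partial_deriv j F) = partial_deriv j (partial_deriv i F)"
  by (rule poly_mapping_eqI)
     (auto simp: lookup_partial_deriv lookup_add lookup_single when_def ac_simps)

lemma comp_fun_commute_partial_deriv:
  "comp_fun_commute (\<lambda>i. (partial_deriv i :: ('i, 'k::comm_ring_1) mpoly \<Rightarrow> _) ^^ e i)"
proof -
  have *: "(partial_deriv i ^^ a) (partial_deriv j F) = partial_deriv j ((partial_deriv i ^^ a) F)"
    for i j a and F :: "('i, 'k) mpoly"
    by (induction a) (auto simp: partial_deriv_commute)
  have "(partial_deriv i ^^ a) ((partial_deriv j ^^ b) F) = (partial_deriv j ^^ b) ((partial_deriv i ^^ a) F)"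
    for i j a b and F :: "('i, 'k) mpoly"
    by (induction b) (auto simp: *)
  then show ?thesis
    by unfold_locales auto
qed

lemma var_diff_action:
  fixes F :: "('i, 'k::comm_ring_1) mpoly"
  shows "var i \<cdot> F = partial_deriv i F"
proof -
  interpret comp_fun_commute
    "\<lambda>j. (partial_deriv j :: ('i, 'k) mpoly \<Rightarrow> _) ^^ Poly_Mapping.lookup (Poly_Mapping.single i 1) j"
    by (rule comp_fun_commute_partial_deriv)
  show ?thesis
    by (simp add: diff_action_def var_def mono_deriv_def smult_def const_def)
qed

end

theory Submission imports Defs begin

text \<open>
  Eliminating $x = v + w$, a polynomial $f$ lies in $J \star K$ if and only if $f(v+w)$ lies in the ideal
  of $\Bbbk[v,w]$ generated by $J(v)$ and $K(w)$. By Taylor's formula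
  $$f(v+w) = \sum_\alpha \frac{1}{\alpha!} (\partial^\alpha f)(v)\, w^\alpha,$$
  so for the pairing with $\langle w^\alpha, \partial^\beta\rangle = \alpha!$ if $\alpha = \beta$ and 0
  otherwise, contracting the $w$-part of $f(v+w)$ with an operator $\delta$ gives exactly
  $\delta\cdot f$ (\<open>contract_shift\<close>).

  If all of $K$ annihilates $\delta$, then this contraction kills the ideal generated by $K(w)$ and maps
  the one generated by $J(v)$ into $J$. Hence $f \in J \star K$ implies $\delta\cdot f \in J$
  (\<open>action_mem_of_mem_join\<close>).

  For the converse, suppose that finitely many $e_t \in R$ and operators $\delta_t$ satisfy
  $g \equiv \sum_t \langle g,\delta_t\rangle e_t$ modulo $K$ for all $g$. Substituting this for every
  $w^\alpha$ in the Taylor formula gives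
  $f(v+w) \equiv \sum_t (\delta_t\cdot f)(v)\, e_t(w)$ modulo $K(w)$, so
  $f \in J \star K$ as soon as all $\delta_t\cdot f$ lie in $J$ (\<open>mem_join_of_action_mem\<close>).

  It remains to find such $e_t$ and $\delta_t$. For $K = \mathfrak B(V)$ the $\delta_t$ are obtained from a
  finite spanning set of $V$ by orthogonalization (\<open>finite_dim_projection\<close>); closure under the bracket
  makes $\mathfrak B(V)$ the whole orthogonal complement of $V$. For an $\mathfrak m$-primary $K = M$ the
  quotient of $R$ by $M$ is finite dimensional, and the coordinate functionals of a monomial basis of it
  are represented by operators in $\mathfrak A(M)$ (\<open>max_primary_projection\<close>).
\<close>

section \<open>Polynomials and evaluation homomorphisms\<close>

abbreviation coef :: "('a \<Rightarrow>\<^sub>0 'b::zero) \<Rightarrow> 'a \<Rightarrow> 'b" where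
  "coef \<equiv> Poly_Mapping.lookup"

abbreviation monom :: "'a \<Rightarrow> 'b \<Rightarrow> ('a \<Rightarrow>\<^sub>0 'b::zero)" where
  "monom \<equiv> Poly_Mapping.single"

abbreviation supp :: "('a \<Rightarrow>\<^sub>0 'b::zero) \<Rightarrow> 'a set" where
  "supp \<equiv> Poly_Mapping.keys"

lemma exponent_induct [case_names zero add]:
  fixes \<alpha> :: "'i \<Rightarrow>\<^sub>0 nat"
  assumes zero: "P 0" and add: "\<And>i \<beta>. P \<beta> \<Longrightarrow> P (monom i 1 + \<beta>)"
  shows "P \<alpha>"
proof (induction \<alpha> rule: update_induct)
  case const
  show ?case by (rule zero)
next
  case (update \<beta> i b)
  have "P (monom i m + \<beta>)" for m
  proof (induction m)
    case 0
    then show ?case using update by simp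
  next
    case (Suc m)
    have "monom i (Suc m) + \<beta> = monom i 1 + (monom i m + \<beta>)"
      by (simp add: add.assoc[symmetric] single_add[symmetric])
    then show ?case using add[OF Suc] by simp
  qed
  moreover have "Poly_Mapping.update i b \<beta> = monom i b + \<beta>"
    using update by (auto intro!: poly_mapping_eqI
        simp: lookup_update lookup_add lookup_single when_def in_keys_iff)
  ultimately show ?case by simp
qed

lemma monomial_induct [case_names single add]:
  fixes f :: "'a \<Rightarrow>\<^sub>0 'b::comm_ring_1"
  assumes single: "\<And>\<alpha> c. P (monom \<alpha> c)" and add: "\<And>f g. P f \<Longrightarrow> P g \<Longrightarrow> P (f + g)"
  shows "P f"
proof (induction f rule: update_induct)
  case const
  show ?case using single[of undefined 0] by simp
next
  case (update f \<alpha> c)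
  have "Poly_Mapping.update \<alpha> c f = monom \<alpha> c + f"
    using update by (auto intro!: poly_mapping_eqI
        simp: lookup_update lookup_add lookup_single when_def in_keys_iff)
  then show ?case using add[OF single update(3)] by simp
qed

text \<open>A statement that survives addition and multiplication by one variable needs no product rule: this is
  the induction used for everything about Taylor expansion below.\<close>
lemma mpoly_induct [case_names const add var_mult]:
  fixes f :: "('i, 'k::comm_ring_1) mpoly"
  assumes const: "\<And>c. P (const c)" and add: "\<And>f g. P f \<Longrightarrow> P g \<Longrightarrow> P (f + g)"
    and var_mult: "\<And>i f. P f \<Longrightarrow> P (var i * f)"
  shows "P f"
proof (induction f rule: monomial_induct)
  case (single \<alpha> c)
  show ?case
  proof (induction \<alpha> rule: exponent_induct)
    case zero
    then show ?case using const[of c] by (simp add: const_def)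
  next
    case (add i \<beta>)
    then show ?case using var_mult[OF add] by (simp add: var_def mult_single)
  qed
qed (rule add)

lemma coef_monom_mult_shift:
  fixes h :: "'a::cancel_comm_monoid_add \<Rightarrow>\<^sub>0 'k::comm_ring_1"
  shows "coef (monom \<alpha> c * h) (\<alpha> + \<beta>) = c * coef h \<beta>"
  by (induction h rule: monomial_induct)
    (auto simp: mult_single lookup_single when_def lookup_add distrib_left)

lemma coef_const_mult: "coef (const c * h) \<alpha> = c * coef h \<alpha>"
  using coef_monom_mult_shift[of 0 c h \<alpha>] by (simp add: const_def)

lemma coef_var_mult:
  fixes h :: "('i, 'k::comm_ring_1) mpoly"
  shows "coef (var j * h) \<alpha> = (if coef \<alpha> j = 0 then 0 else coef h (\<alpha> - monom j 1))"
proof (cases "coef \<alpha> j = 0")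
  case True
  have "coef (var j * h) \<alpha> = 0"
  proof (induction h rule: monomial_induct)
    case (single \<beta> c)
    have "monom j 1 + \<beta> \<noteq> \<alpha>" using True by (auto simp: lookup_add)
    then show ?case by (simp add: var_def mult_single lookup_single)
  qed (simp add: distrib_left lookup_add)
  then show ?thesis using True by simp
next
  case False
  then have "\<alpha> = monom j 1 + (\<alpha> - monom j 1)"
    by (auto intro!: poly_mapping_eqI simp: lookup_add lookup_minus lookup_single when_def)
  then show ?thesis
    using coef_monom_mult_shift[of "monom j 1" 1 h "\<alpha> - monom j 1"] False by (simp add: var_def)
qed

lemma const_0 [simp]: "const 0 = 0" and const_1 [simp]: "const 1 = 1"
  by (simp_all add: const_def)

lemma coef_const_self [simp]: "coef (const c) 0 = c"
  by (simp add: const_def)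

lemma const_sum: "const (\<Sum>x\<in>A. g x) = (\<Sum>x\<in>A. const (g x))"
  by (induction A rule: infinite_finite_induct) (auto simp: const_add)

lemma of_nat_mpoly: "(of_nat m :: ('i, 'k::comm_ring_1) mpoly) = const (of_nat m)"
  by (simp add: const_def)

definition ring_hom :: "('a::comm_ring_1 \<Rightarrow> 'b::comm_ring_1) \<Rightarrow> bool" where
  "ring_hom h \<longleftrightarrow> h 1 = 1 \<and> (\<forall>a b. h (a + b) = h a + h b) \<and> (\<forall>a b. h (a * b) = h a * h b)"

lemma ring_homD:
  assumes "ring_hom h"
  shows "h 1 = 1" "h (a + b) = h a + h b" "h (a * b) = h a * h b" "h 0 = 0"
    "h (a - b) = h a - h b"
proof -
  show *: "h 1 = 1" "h (a + b) = h a + h b" "h (a * b) = h a * h b" for a b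
    using assms by (auto simp: ring_hom_def)
  show "h 0 = 0" using *(2)[of 0 0] by simp
  show "h (a - b) = h a - h b" using *(2)[of "a - b" b] by (simp add: algebra_simps)
qed

lemma ring_hom_sum: "ring_hom h \<Longrightarrow> h (\<Sum>x\<in>A. g x) = (\<Sum>x\<in>A. h (g x))"
  by (induction A rule: infinite_finite_induct) (auto simp: ring_homD)

lemma ring_hom_compose: "ring_hom g \<Longrightarrow> ring_hom h \<Longrightarrow> ring_hom (\<lambda>x. g (h x))"
  by (simp add: ring_hom_def)

lemma ring_hom_const: "ring_hom const"
  by (simp add: ring_hom_def const_add const_mult)

lemma ring_hom_eqI:
  assumes "ring_hom g" "ring_hom h" "\<And>c. g (const c) = h (const c)" "\<And>i. g (var i) = h (var i)"
  shows "g f = h f"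
  by (induction f rule: mpoly_induct) (auto simp: assms ring_homD[OF assms(1)] ring_homD[OF assms(2)])

text \<open>Unlike \<^const>\<open>subst\<close>, the coefficients are transported as well. This is what makes
  $\Bbbk[v,w]$, read as polynomials in $w$ with coefficients in $\Bbbk[v]$, a possible source and
  target of evaluations.\<close>
definition eval ::
  "('a \<Rightarrow> 'b::comm_ring_1) \<Rightarrow> ('i \<Rightarrow> 'b) \<Rightarrow> ('i, 'a::comm_ring_1) mpoly \<Rightarrow> 'b" where
  "eval \<phi> \<sigma> f = (\<Sum>\<alpha>\<in>supp f. \<phi> (coef f \<alpha>) * (\<Prod>i\<in>supp \<alpha>. \<sigma> i ^ coef \<alpha> i))"

lemma subst_eq_eval: "subst = eval const"
  by (intro ext) (simp add: subst_def eval_def)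

lemma eval_monom:
  assumes "ring_hom \<phi>"
  shows "eval \<phi> \<sigma> (monom \<alpha> c) = \<phi> c * (\<Prod>i\<in>supp \<alpha>. \<sigma> i ^ coef \<alpha> i)"
  by (simp add: eval_def ring_homD[OF assms])

lemma eval_const: "ring_hom \<phi> \<Longrightarrow> eval \<phi> \<sigma> (const c) = \<phi> c"
  by (simp add: const_def eval_monom)

lemma eval_var: "ring_hom \<phi> \<Longrightarrow> eval \<phi> \<sigma> (var i) = \<sigma> i"
  by (simp add: var_def eval_monom ring_homD)

lemma eval_add:
  assumes "ring_hom \<phi>"
  shows "eval \<phi> \<sigma> (f + g) = eval \<phi> \<sigma> f + eval \<phi> \<sigma> g"
  unfolding eval_def
  by (rule setsum_keys_plus_distrib) (simp_all add: ring_homD[OF assms] distrib_right)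

lemma exponent_prod_add:
  fixes \<sigma> :: "'i \<Rightarrow> 'b::comm_ring_1" and \<alpha> \<beta> :: "'i \<Rightarrow>\<^sub>0 nat"
  shows "(\<Prod>i\<in>supp (\<alpha> + \<beta>). \<sigma> i ^ coef (\<alpha> + \<beta>) i) =
    (\<Prod>i\<in>supp \<alpha>. \<sigma> i ^ coef \<alpha> i) * (\<Prod>i\<in>supp \<beta>. \<sigma> i ^ coef \<beta> i)"
proof -
  have *: "(\<Prod>i\<in>supp \<gamma>. \<sigma> i ^ coef \<gamma> i) = (\<Prod>i\<in>supp \<alpha> \<union> supp \<beta>. \<sigma> i ^ coef \<gamma> i)"
    if "supp \<gamma> \<subseteq> supp \<alpha> \<union> supp \<beta>" for \<gamma> :: "'i \<Rightarrow>\<^sub>0 nat"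
    using that by (intro prod.mono_neutral_left) (auto simp: in_keys_iff)
  show ?thesis
    using *[OF keys_add] *[of \<alpha>] *[of \<beta>] by (simp add: lookup_add power_add prod.distrib)
qed

lemma ring_hom_eval:
  assumes "ring_hom \<phi>"
  shows "ring_hom (eval \<phi> \<sigma>)"
proof -
  note [simp] = eval_add[OF assms] eval_monom[OF assms] ring_homD[OF assms]
  have monom: "eval \<phi> \<sigma> (monom \<alpha> a * g) = eval \<phi> \<sigma> (monom \<alpha> a) * eval \<phi> \<sigma> g" for \<alpha> a g
  proof (induction g rule: monomial_induct)
    case (single \<beta> b)
    then show ?case by (simp add: mult_single exponent_prod_add mult_ac)
  next
    case (add f g)
    then show ?case by (simp only: distrib_left eval_add[OF assms])
  qed
  have "eval \<phi> \<sigma> (f * g) = eval \<phi> \<sigma> f * eval \<phi> \<sigma> g" for f g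
  proof (induction f rule: monomial_induct)
    case (single \<alpha> a)
    then show ?case by (rule monom)
  next
    case (add f h)
    then show ?case by (simp only: distrib_right eval_add[OF assms])
  qed
  then show ?thesis
    using eval_const[OF assms, of \<sigma> 1] by (simp add: ring_hom_def)
qed

text \<open>The coefficient map \<open>\<psi>\<close> on the right is arbitrary because a monic monomial only has the
  coefficients 0 and 1; it lets the monomials be rewritten by \<^const>\<open>subst\<close> whatever \<open>\<phi>\<close> is.\<close>
lemma eval_expand:
  assumes "ring_hom \<phi>" "ring_hom \<psi>"
  shows "eval \<phi> \<sigma> f = (\<Sum>\<alpha>\<in>supp f. \<phi> (coef f \<alpha>) * eval \<psi> \<sigma> (monom \<alpha> 1))"
  by (simp add: eval_monom[OF assms(2)] ring_homD[OF assms(2)] eval_def[of \<phi>])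

section \<open>Derivatives\<close>

definition exp_fact :: "('i::finite \<Rightarrow>\<^sub>0 nat) \<Rightarrow> nat" where
  "exp_fact \<alpha> = (\<Prod>i\<in>UNIV. fact (coef \<alpha> i))"

lemma exp_fact_0 [simp]: "exp_fact 0 = 1"
  by (simp add: exp_fact_def)

lemma exp_fact_nonzero [simp]: "exp_fact \<alpha> \<noteq> 0"
  by (simp add: exp_fact_def)

lemma exp_fact_add: "exp_fact (monom i 1 + \<alpha>) = (coef \<alpha> i + 1) * exp_fact \<alpha>"
proof -
  have "exp_fact (monom i 1 + \<alpha>) =
      fact (Suc (coef \<alpha> i)) * (\<Prod>j\<in>UNIV - {i}. fact (coef (monom i 1 + \<alpha>) j))"
    unfolding exp_fact_def by (subst prod.remove[of UNIV i]) (auto simp: lookup_add)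
  also have "(\<Prod>j\<in>UNIV - {i}. fact (coef (monom i 1 + \<alpha>) j)) = (\<Prod>j\<in>UNIV - {i}. fact (coef \<alpha> j) :: nat)"
    by (intro prod.cong) (auto simp: lookup_add lookup_single when_def)
  finally show ?thesis
    unfolding exp_fact_def by (subst (2) prod.remove[of UNIV i]) (auto simp: algebra_simps)
qed

text \<open>Folding over all variables instead of the support makes the operators for different exponents
  comparable: a variable with exponent 0 contributes the identity.\<close>
lemma mono_deriv_UNIV:
  fixes F :: "('i::finite, 'k::comm_ring_1) mpoly"
  shows "mono_deriv \<alpha> F = Finite_Set.fold (\<lambda>i. partial_deriv i ^^ coef \<alpha> i) F UNIV"
proof -
  interpret comp_fun_commute "\<lambda>i. (partial_deriv i :: ('i, 'k) mpoly \<Rightarrow> _) ^^ coef \<alpha> i"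
    by (rule comp_fun_commute_partial_deriv)
  have "D \<inter> supp \<alpha> = {} \<Longrightarrow> Finite_Set.fold (\<lambda>i. partial_deriv i ^^ coef \<alpha> i) F (supp \<alpha> \<union> D) =
      Finite_Set.fold (\<lambda>i. partial_deriv i ^^ coef \<alpha> i) F (supp \<alpha>)" if "finite D" for D
    using that by (induction D) (auto simp: in_keys_iff)
  from this[of "- supp \<alpha>"] show ?thesis
    by (simp add: mono_deriv_def)
qed

lemma mono_deriv_0 [simp]: "mono_deriv 0 F = F"
  by (simp add: mono_deriv_def)

lemma mono_deriv_step:
  fixes F :: "('i::finite, 'k::comm_ring_1) mpoly"
  shows "mono_deriv (monom i 1 + \<alpha>) F = partial_deriv i (mono_deriv \<alpha> F)"
proof -
  let ?D = "\<lambda>\<beta> j. (partial_deriv j :: ('i, 'k) mpoly \<Rightarrow> _) ^^ coef \<beta> j"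
  interpret C: comp_fun_commute "?D \<beta>" for \<beta> :: "'i \<Rightarrow>\<^sub>0 nat"
    by (rule comp_fun_commute_partial_deriv)
  have split: "mono_deriv \<beta> F = (partial_deriv i ^^ coef \<beta> i) (Finite_Set.fold (?D \<beta>) F (- {i}))" for \<beta>
  proof -
    have "(UNIV :: 'i set) = insert i (- {i})" by auto
    then have "mono_deriv \<beta> F = Finite_Set.fold (?D \<beta>) F (insert i (- {i}))"
      using mono_deriv_UNIV by metis
    then show ?thesis by simp
  qed
  have "Finite_Set.fold (?D (monom i 1 + \<alpha>)) F (- {i}) = Finite_Set.fold (?D \<alpha>) F (- {i})"
    by (rule fold_closed_eq[where B = UNIV]) (auto simp: lookup_add lookup_single)
  then show ?thesis
    unfolding split[of "monom i 1 + \<alpha>"] split[of \<alpha>] by (simp add: lookup_add)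
qed

lemma partial_deriv_add: "partial_deriv i (f + g) = partial_deriv i f + partial_deriv i g"
  by (rule poly_mapping_eqI) (simp add: lookup_partial_deriv lookup_add distrib_left del: of_nat_add)

lemma partial_deriv_const_mult: "partial_deriv i (const c * f) = const c * partial_deriv i f"
  by (rule poly_mapping_eqI) (simp add: lookup_partial_deriv coef_const_mult mult.left_commute del: of_nat_add)

lemma partial_deriv_of_nat_mult: "partial_deriv i (of_nat m * f) = of_nat m * partial_deriv i f"
  by (simp add: of_nat_mpoly partial_deriv_const_mult)

lemma partial_deriv_var_mult:
  "partial_deriv i (var j * f) = (if i = j then f else 0) + var j * partial_deriv i f"
proof (rule poly_mapping_eqI)
  fix \<beta>
  show "coef (partial_deriv i (var j * f)) \<beta> =
      coef ((if i = j then f else 0) + var j * partial_deriv i f) \<beta>"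
  proof (cases "coef \<beta> j = 0")
    case True
    then show ?thesis
      by (auto simp: lookup_partial_deriv coef_var_mult lookup_add lookup_single when_def)
  next
    case False
    then have "\<beta> + monom i 1 - monom j 1 = \<beta> - monom j 1 + monom i 1"
      by (auto intro!: poly_mapping_eqI simp: lookup_add lookup_minus lookup_single when_def)
    moreover have "i = j \<Longrightarrow> \<beta> - monom j 1 + monom i 1 = \<beta>"
      using False by (auto intro!: poly_mapping_eqI simp: lookup_add lookup_minus lookup_single when_def)
    ultimately show ?thesis
      using False
      by (cases "coef \<beta> j")
        (auto simp: lookup_partial_deriv coef_var_mult lookup_add lookup_minus lookup_single when_def distrib_right)
  qed
qed

lemma monom_1_add_neq_0: "monom i (1::nat) + \<alpha> \<noteq> 0"
proof
  assume "monom i 1 + \<alpha> = 0"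
  then have "coef (monom i 1 + \<alpha>) i = 0" by simp
  then show False by (simp add: lookup_add)
qed

lemma partial_deriv_const: "partial_deriv i (const c) = 0"
  using monom_1_add_neq_0[of i]
  by (intro poly_mapping_eqI) (simp add: lookup_partial_deriv const_def lookup_single_not_eq add.commute)

section \<open>Taylor expansion\<close>

text \<open>This is $f \mapsto f(v+w)$, where $\Bbbk[v,w]$ is read as the ring of polynomials in $w$ over
  $\Bbbk[v]$; so \<open>var i\<close> is $w_i$ and \<open>const (var i)\<close> is $v_i$.\<close>
definition shift :: "('n, 'k::comm_ring_1) mpoly \<Rightarrow> ('n, ('n, 'k) mpoly) mpoly" where
  "shift = eval (\<lambda>c. const (const c)) (\<lambda>i. const (var i) + var i)"

lemma ring_hom_const_const: "ring_hom (\<lambda>c. const (const c))"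
  by (intro ring_hom_compose[OF ring_hom_const] ring_hom_const)

lemma ring_hom_shift: "ring_hom shift"
  unfolding shift_def by (intro ring_hom_eval ring_hom_const_const)

lemma shift_const: "shift (const c) = const (const c)"
  and shift_var: "shift (var i) = const (var i) + var i"
  unfolding shift_def by (simp_all add: eval_const eval_var ring_hom_const_const)

lemma coef_shift_var_mult:
  "coef (shift (var j * f)) \<alpha> = var j * coef (shift f) \<alpha> +
    (if coef \<alpha> j = 0 then 0 else coef (shift f) (\<alpha> - monom j 1))"
  by (simp add: ring_homD[OF ring_hom_shift] shift_var distrib_right lookup_add coef_const_mult coef_var_mult)

text \<open>This is $\partial_{v_i} f(v+w) = \partial_{w_i} f(v+w)$, compared at the coefficient of
  $w^\alpha$.\<close>
lemma deriv_coef_shift: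
  "partial_deriv i (coef (shift f) \<alpha>) = of_nat (coef \<alpha> i + 1) * coef (shift f) (monom i 1 + \<alpha>)"
proof (induction f arbitrary: \<alpha> rule: mpoly_induct)
  case (const c)
  have "coef (shift (const c)) (monom i 1 + \<alpha>) = 0"
    using monom_1_add_neq_0[of i \<alpha>]
    by (simp add: shift_const const_def[of "const c"] lookup_single_not_eq)
  moreover have "partial_deriv i (coef (shift (const c)) \<alpha>) = 0"
    using partial_deriv_const[of i c] partial_deriv_const[of i "0::'b"]
    by (simp add: shift_const const_def[of "const c"] lookup_single when_def)
  ultimately show ?case by simp
next
  case (add f g)
  then show ?case
    by (simp add: ring_homD[OF ring_hom_shift] lookup_add partial_deriv_add distrib_left del: of_nat_add)
next
  case (var_mult j f)
  show ?case
  proof (cases "coef \<alpha> j = 0")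
    case True
    then show ?thesis
      using var_mult[of \<alpha>]
      by (auto simp: coef_shift_var_mult partial_deriv_var_mult lookup_add lookup_single when_def mult.left_commute)
  next
    case False
    then have "monom i 1 + \<alpha> - monom j 1 = monom i 1 + (\<alpha> - monom j 1)"
      by (auto intro!: poly_mapping_eqI simp: lookup_add lookup_minus lookup_single when_def)
    moreover have "i = j \<Longrightarrow> monom i 1 + (\<alpha> - monom j 1) = \<alpha>"
      using False by (auto intro!: poly_mapping_eqI simp: lookup_add lookup_minus lookup_single when_def)
    ultimately show ?thesis
      unfolding coef_shift_var_mult
      using False var_mult[of \<alpha>] var_mult[of "\<alpha> - monom j 1"]
      by (cases "coef \<alpha> j")
        (auto simp: partial_deriv_var_mult partial_deriv_add
          lookup_add lookup_minus lookup_single when_def algebra_simps)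
  qed
qed

lemma coef_shift_0: "coef (shift f) 0 = f"
proof (induction f rule: mpoly_induct)
  case (add f g)
  then show ?case by (simp add: ring_homD[OF ring_hom_shift] lookup_add)
qed (simp_all add: shift_const coef_shift_var_mult)

text \<open>Each differentiation moves to the next Taylor coefficient, starting from $f(v+0) = f$. Keeping
  $\alpha!$ on the side of the Taylor coefficient avoids any division.\<close>
lemma taylor_coefficient:
  fixes f :: "('n::finite, 'k::comm_ring_1) mpoly"
  shows "mono_deriv \<alpha> f = of_nat (exp_fact \<alpha>) * coef (shift f) \<alpha>"
proof (induction \<alpha> rule: exponent_induct)
  case zero
  then show ?case by (simp add: coef_shift_0)
next
  case (add i \<beta>)
  then show ?case
    by (simp only: mono_deriv_step partial_deriv_of_nat_mult deriv_coef_shift exp_fact_add of_nat_mult mult_ac)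
qed

section \<open>The pairing between polynomials and differential operators\<close>

text \<open>For $\delta \in \Bbbk[\partial]$, this is the $\Bbbk[v]$-linear extension to $\Bbbk[v,w]$ of the
  functional $\langle\cdot,\delta\rangle$ on $\Bbbk[w]$, where
  $\langle w^\alpha, \partial^\beta\rangle$ is $\alpha!$ if $\alpha = \beta$ and 0 otherwise.\<close>
definition contract ::
  "('n::finite, 'k::comm_ring_1) mpoly \<Rightarrow> ('n, ('n, 'k) mpoly) mpoly \<Rightarrow> ('n, 'k) mpoly" where
  "contract \<delta> h = (\<Sum>\<alpha>\<in>supp \<delta>. coef h \<alpha> * const (of_nat (exp_fact \<alpha>) * coef \<delta> \<alpha>))"

text \<open>The same pairing over $\Bbbk$; $\langle g,\delta\rangle$ is the constant coefficient of
  $g\cdot\delta$.\<close>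
definition pair :: "('n::finite, 'k::comm_ring_1) mpoly \<Rightarrow> ('n, 'k) mpoly \<Rightarrow> 'k" where
  "pair g \<delta> = (\<Sum>\<alpha>\<in>supp \<delta>. coef g \<alpha> * (of_nat (exp_fact \<alpha>) * coef \<delta> \<alpha>))"

text \<open>Contracting the Taylor expansion of $f$ with $\delta$ cancels the factorials, so it recovers the
  application of $\delta$ to $f$. All further arguments meet differential operators only through this
  identity.\<close>
lemma contract_shift: "contract \<delta> (shift f) = \<delta> \<cdot> f"
  unfolding contract_def diff_action_def
  by (simp add: taylor_coefficient smult_def const_mult of_nat_mpoly mult_ac)

lemma pair_superset:
  assumes "finite S" "supp \<delta> \<subseteq> S"
  shows "pair g \<delta> = (\<Sum>\<alpha>\<in>S. coef g \<alpha> * (of_nat (exp_fact \<alpha>) * coef \<delta> \<alpha>))"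
  unfolding pair_def using assms by (intro sum.mono_neutral_left) (auto simp: in_keys_iff)

lemma pair_commute: "pair g \<delta> = pair \<delta> g"
  using pair_superset[of "supp g \<union> supp \<delta>" \<delta> g] pair_superset[of "supp g \<union> supp \<delta>" g \<delta>]
  by (simp add: mult_ac)

lemma pair_add_left: "pair (f + g) \<delta> = pair f \<delta> + pair g \<delta>"
  by (simp add: pair_def lookup_add distrib_right sum.distrib)

lemma pair_diff_left: "pair (f - g) \<delta> = pair f \<delta> - pair g \<delta>"
  by (simp add: pair_def lookup_minus left_diff_distrib sum_subtractf)

lemma pair_const_mult_left: "pair (const c * f) \<delta> = c * pair f \<delta>"
  by (simp add: pair_def coef_const_mult sum_distrib_left mult.assoc)

lemma pair_0_left [simp]: "pair 0 \<delta> = 0"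
  by (simp add: pair_def)

lemma pair_monom: "pair (monom \<alpha> c) \<delta> = c * (of_nat (exp_fact \<alpha>) * coef \<delta> \<alpha>)"
  by (simp add: pair_commute[of "monom \<alpha> c"]) (simp add: pair_def mult_ac)

lemma coef_mono_deriv:
  fixes F :: "('n::finite, 'k::comm_ring_1) mpoly"
  shows "of_nat (exp_fact \<beta>) * coef (mono_deriv \<alpha> F) \<beta> = of_nat (exp_fact (\<alpha> + \<beta>)) * coef F (\<alpha> + \<beta>)"
proof (induction \<alpha> arbitrary: \<beta> rule: exponent_induct)
  case (add i \<alpha>)
  have "of_nat (exp_fact \<beta>) * coef (mono_deriv (monom i 1 + \<alpha>) F) \<beta> =
      of_nat (exp_fact (monom i 1 + \<beta>)) * coef (mono_deriv \<alpha> F) (monom i 1 + \<beta>)"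
    unfolding mono_deriv_step lookup_partial_deriv exp_fact_add
    by (simp only: of_nat_mult mult_ac add.commute[of \<beta>])
  then show ?case
    unfolding add by (simp add: add_ac)
qed simp

lemma action_add_left: "(f + g) \<cdot> F = f \<cdot> F + g \<cdot> F"
  unfolding diff_action_def
  by (rule setsum_keys_plus_distrib) (simp_all add: smult_def const_add distrib_right)

lemma action_monom: "monom \<alpha> c \<cdot> F = const c * mono_deriv \<alpha> F"
  by (simp add: diff_action_def smult_def)

text \<open>All coefficients of $f\cdot F$, and not only the constant one, are values of the pairing.\<close>
lemma coef_action:
  "of_nat (exp_fact \<beta>) * coef (f \<cdot> F) \<beta> = pair (monom \<beta> 1 * f) F"
proof (induction f rule: monomial_induct)
  case (single \<alpha> c)
  then show ?case
    using coef_mono_deriv[of \<beta> \<alpha> F]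
    by (simp add: action_monom coef_const_mult mult_single pair_monom mult.left_commute add.commute)
qed (simp add: action_add_left lookup_add distrib_left pair_add_left)

text \<open>Multiplication by a monomial and the corresponding derivative are adjoint.\<close>
lemma pair_monom_mult: "pair (monom \<beta> 1 * f) F = pair f (mono_deriv \<beta> F)"
proof (induction f rule: monomial_induct)
  case (single \<alpha> c)
  then show ?case
    using coef_mono_deriv[of \<alpha> \<beta> F] by (simp add: mult_single pair_monom)
qed (simp add: distrib_left pair_add_left)

text \<open>In characteristic zero the factor $\beta!$ in front of a coefficient of $f\cdot F$ can be cancelled.
  So for an ideal, annihilating $F$ and being orthogonal to $F$ are the same condition.\<close>
lemma action_eq_0_iff:
  fixes f F :: "('n::finite, 'k::field_char_0) mpoly"
  shows "f \<cdot> F = 0 \<longleftrightarrow> (\<forall>\<beta>. pair (monom \<beta> 1 * f) F = 0)"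
proof -
  have "coef (f \<cdot> F) \<beta> = 0 \<longleftrightarrow> pair (monom \<beta> 1 * f) F = 0" for \<beta>
    using coef_action[of \<beta> f F] by (metis exp_fact_nonzero mult_eq_0_iff of_nat_eq_0_iff)
  then show ?thesis
    by (metis lookup_zero poly_mapping_eqI)
qed

section \<open>Elements of the join\<close>

interpretation ideal: module "(*) :: 'a::comm_ring_1 \<Rightarrow> 'a \<Rightarrow> 'a"
  by (rule module_times)

text \<open>For the multiplication of a ring this simplification rule is associativity, which conflicts with
  \<open>mult.assoc\<close>.\<close>

declare ideal.scale_scale [simp del]

interpretation poly_space: vector_space "smult :: 'k::field \<Rightarrow> ('i, 'k) mpoly \<Rightarrow> _"
  by (rule vector_space_smult)

text \<open>The inclusion of $\Bbbk[w]$ into the polynomials in $w$ over $\Bbbk[v]$.\<close>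
definition embed :: "('n, 'k::comm_ring_1) mpoly \<Rightarrow> ('n, ('n, 'k) mpoly) mpoly" where
  "embed = eval (\<lambda>c. const (const c)) var"

lemma ring_hom_embed: "ring_hom embed"
  unfolding embed_def by (intro ring_hom_eval ring_hom_const_const)

lemma embed_const: "embed (const c) = const (const c)" and embed_var: "embed (var i) = var i"
  by (simp_all add: embed_def eval_const eval_var ring_hom_const_const)

lemma coef_embed: "coef (embed f) \<alpha> = const (coef f \<alpha>)"
proof (induction f arbitrary: \<alpha> rule: mpoly_induct)
  case (const c)
  then show ?case
    by (simp add: embed_const) (simp add: const_def lookup_single when_def)
next
  case (add f g)
  then show ?case by (simp add: ring_homD[OF ring_hom_embed] lookup_add const_add)
next
  case (var_mult i f)
  then show ?case by (simp add: ring_homD[OF ring_hom_embed] embed_var coef_var_mult)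
qed

lemma embed_monom: "embed (monom \<alpha> 1) = monom \<alpha> 1"
  by (rule poly_mapping_eqI) (simp add: coef_embed lookup_single when_def)

lemma contract_add: "contract \<delta> (g + h) = contract \<delta> g + contract \<delta> h"
  by (simp add: contract_def lookup_add distrib_right sum.distrib)

lemma contract_const_mult: "contract \<delta> (const r * h) = r * contract \<delta> h"
  by (simp add: contract_def coef_const_mult sum_distrib_left mult.assoc)

lemma contract_0 [simp]: "contract \<delta> 0 = 0"
  by (simp add: contract_def)

lemma contract_embed: "contract \<delta> (embed g) = const (pair g \<delta>)"
  by (simp add: contract_def pair_def coef_embed const_sum const_mult)

text \<open>The contraction is linear over $\Bbbk[v]$, so only multiples of $k(w)$ by monomials in $w$ matter, and
  these are the pairings that vanish when $k$ annihilates $\delta$.\<close>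
lemma contract_mult_embed_eq_0:
  fixes \<delta> k :: "('n::finite, 'k::field_char_0) mpoly"
  assumes "k \<cdot> \<delta> = 0"
  shows "contract \<delta> (h * embed k) = 0"
proof (induction h rule: monomial_induct)
  case (single \<beta> r)
  have "monom \<beta> r * embed k = const r * embed (monom \<beta> 1 * k)"
    by (simp add: ring_homD[OF ring_hom_embed] embed_monom const_def mult_single mult.assoc[symmetric])
  then show ?case
    using assms by (simp add: contract_const_mult contract_embed action_eq_0_iff)
next
  case (add f g)
  then show ?case by (simp add: distrib_right contract_add)
qed

text \<open>Elimination of $x$: the homomorphism $\Bbbk[x,v,w] \to \Bbbk[v,w]$ with $x_i \mapsto v_i + w_i$.\<close>
definition split_vars :: "('n join_var, 'k::comm_ring_1) mpoly \<Rightarrow> ('n, ('n, 'k) mpoly) mpoly" where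
  "split_vars = eval (\<lambda>c. const (const c)) (\<lambda>z. case z of
     Xvar i \<Rightarrow> const (var i) + var i | Vvar i \<Rightarrow> const (var i) | Wvar i \<Rightarrow> var i)"

lemma ring_hom_split_vars: "ring_hom split_vars"
  unfolding split_vars_def by (intro ring_hom_eval ring_hom_const_const)

lemma ring_hom_subst: "ring_hom (subst \<sigma>)"
  unfolding subst_eq_eval by (intro ring_hom_eval ring_hom_const)

lemma subst_const: "subst \<sigma> (const c) = const c" and subst_var: "subst \<sigma> (var i) = \<sigma> i"
  by (simp_all add: subst_eq_eval eval_const eval_var ring_hom_const)

lemma split_vars_const: "split_vars (const c) = const (const c)"
  and split_vars_var: "split_vars (var (Xvar i)) = const (var i) + var i"
    "split_vars (var (Vvar i)) = const (var i)" "split_vars (var (Wvar i)) = var i"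
  by (simp_all add: split_vars_def eval_const eval_var ring_hom_const_const)

lemma split_vars_subst:
  "split_vars (subst (\<lambda>i. var (Xvar i)) f) = shift f"
  "split_vars (subst (\<lambda>i. var (Vvar i)) f) = const f"
  "split_vars (subst (\<lambda>i. var (Wvar i)) f) = embed f"
  by (rule ring_hom_eqI[of "\<lambda>f. split_vars (subst _ f)"];
      simp add: ring_hom_compose[OF ring_hom_split_vars ring_hom_subst] ring_hom_shift
        ring_hom_const ring_hom_embed subst_const subst_var split_vars_const split_vars_var
        shift_const shift_var embed_const embed_var)+

lemma ideal_add: "is_ideal J \<Longrightarrow> a \<in> J \<Longrightarrow> b \<in> J \<Longrightarrow> a + b \<in> J"
  and ideal_mult: "is_ideal J \<Longrightarrow> a \<in> J \<Longrightarrow> r * a \<in> J"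
  and ideal_zero: "is_ideal J \<Longrightarrow> 0 \<in> J"
  by (simp_all add: ideal.subspace_def)

text \<open>Consider the additive map $\Bbbk[x,v,w] \to R$ that eliminates $x$ and then contracts with $\delta$.
  It kills all multiples of $x_i - v_i - w_i$ and of $K(w)$, maps multiples of $J(v)$ into $J$, and
  sends $f(x)$ to $\delta\cdot f$.\<close>
lemma action_mem_of_mem_join:
  fixes J K :: "('n::finite, 'k::field_char_0) mpoly set"
  assumes J: "is_ideal J" and \<delta>: "\<And>k. k \<in> K \<Longrightarrow> k \<cdot> \<delta> = 0" and f: "f \<in> J \<star> K"
  shows "\<delta> \<cdot> f \<in> J"
proof -
  note hom = ring_homD[OF ring_hom_split_vars]
  have "contract \<delta> (split_vars (subst (\<lambda>i. var (Xvar i)) f)) \<in> J"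
    using f unfolding ideal_join_def mem_Collect_eq
  proof (induction rule: ideal.span_induct_alt)
    case base
    then show ?case using J by (simp add: hom ideal_zero)
  next
    case (step c s y)
    have "contract \<delta> (split_vars c * split_vars s) \<in> J"
      using step(1)
    proof (elim UnE imageE rangeE)
      fix j assume "j \<in> J" "s = subst (\<lambda>i. var (Vvar i)) j"
      then show ?thesis
        using J by (simp add: split_vars_subst mult.commute[of "split_vars c"]
            contract_const_mult mult.commute[of j] ideal_mult)
    next
      fix k assume "k \<in> K" "s = subst (\<lambda>i. var (Wvar i)) k"
      then show ?thesis
        using J \<delta> by (simp add: split_vars_subst contract_mult_embed_eq_0 ideal_zero)
    next
      fix i assume "s = var (Xvar i) - var (Vvar i) - var (Wvar i)"
      then have "split_vars s = 0" by (simp add: hom split_vars_var)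
      then show ?thesis using J by (simp add: ideal_zero)
    qed
    then show ?case using step J by (simp add: hom contract_add ideal_add)
  qed
  then show ?thesis by (simp add: split_vars_subst contract_shift)
qed

lemma contract_eq_sum_pair:
  "contract \<delta> h = (\<Sum>\<alpha>\<in>supp h. coef h \<alpha> * const (pair (monom \<alpha> 1) \<delta>))"
proof -
  have "contract \<delta> h = (\<Sum>\<alpha>\<in>supp h \<union> supp \<delta>. coef h \<alpha> * const (pair (monom \<alpha> 1) \<delta>))"
    unfolding contract_def pair_monom mult_1_left
    by (intro sum.mono_neutral_left) (auto simp: in_keys_iff)
  also have "\<dots> = (\<Sum>\<alpha>\<in>supp h. coef h \<alpha> * const (pair (monom \<alpha> 1) \<delta>))"
    by (intro sum.mono_neutral_right) (auto simp: in_keys_iff)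
  finally show ?thesis .
qed

definition join_gens ::
  "('n, 'k::comm_ring_1) mpoly set \<Rightarrow> ('n, 'k) mpoly set \<Rightarrow> ('n join_var, 'k) mpoly set" where
  "join_gens J K = subst (\<lambda>i. var (Vvar i)) ` J \<union> subst (\<lambda>i. var (Wvar i)) ` K \<union>
      range (\<lambda>i. var (Xvar i) - var (Vvar i) - var (Wvar i))"

text \<open>$f(x) \equiv f(v+w)$ modulo the elements $x_i - v_i - w_i$.\<close>
lemma subst_Xvar_cong:
  fixes f :: "('n, 'k::comm_ring_1) mpoly"
  shows "subst (\<lambda>i. var (Xvar i)) f -
     eval (subst (\<lambda>i. var (Vvar i))) (\<lambda>i. var (Wvar i)) (shift f) \<in> ideal_gen (join_gens J K)"
proof -
  define X where "X = (subst (\<lambda>i. var (Xvar i)) :: ('n, 'k) mpoly \<Rightarrow> _)"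
  define D where "D = (eval (subst (\<lambda>i. var (Vvar i))) (\<lambda>i. var (Wvar i)) :: ('n, ('n, 'k) mpoly) mpoly \<Rightarrow> _)"
  have D: "ring_hom D" unfolding D_def by (intro ring_hom_eval ring_hom_subst)
  have X: "ring_hom X" unfolding X_def by (rule ring_hom_subst)
  note [simp] = ring_homD[OF ring_hom_shift] ring_homD[OF D] ring_homD[OF X]
  have "X f - D (shift f) \<in> ideal_gen (join_gens J K)"
  proof (induction f rule: mpoly_induct)
    case (const c)
    have "X (const c) = D (shift (const c))"
      by (simp add: X_def D_def shift_const eval_const ring_hom_subst subst_const)
    then show ?case by (simp add: ideal.span_zero)
  next
    case (add f g)
    have "X (f + g) - D (shift (f + g)) = (X f - D (shift f)) + (X g - D (shift g))"
      by simp
    then show ?case using add by (metis ideal.span_add)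
  next
    case (var_mult i f)
    have "X (var i) - D (shift (var i)) = var (Xvar i) - var (Vvar i) - var (Wvar i)"
      by (simp add: shift_var) (simp add: X_def D_def subst_var eval_const eval_var ring_hom_subst)
    then have gen: "X (var i) - D (shift (var i)) \<in> ideal_gen (join_gens J K)"
      by (auto simp: join_gens_def intro: ideal.span_base)
    have "X (var i * f) - D (shift (var i * f)) =
        X (var i) * (X f - D (shift f)) + D (shift f) * (X (var i) - D (shift (var i)))"
      by (simp add: algebra_simps)
    then show ?case
      using ideal.span_add[OF ideal.span_scale[OF var_mult] ideal.span_scale[OF gen]] by metis
  qed
  then show ?thesis unfolding X_def D_def .
qed

text \<open>The hypothesis on \<open>K\<close> says that modulo \<open>K\<close> every $g$ is the combination
  $\sum_t \langle g,\delta_t\rangle e_t$. Applied to the monomials $w^\alpha$ of $f(v+w)$, it gives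
  $f(v+w) \equiv \sum_t (\delta_t\cdot f)(v)\, e_t(w)$ modulo \<open>K(w)\<close>, and the right-hand side lies
  in the ideal generated by \<open>J(v)\<close>.\<close>
lemma mem_join_of_action_mem:
  fixes J K :: "('n::finite, 'k::comm_ring_1) mpoly set"
  assumes K: "\<And>g. g - (\<Sum>t\<in>T. const (pair g (\<delta> t)) * e t) \<in> K"
    and J: "\<And>t. t \<in> T \<Longrightarrow> \<delta> t \<cdot> f \<in> J"
  shows "f \<in> J \<star> K"
proof -
  let ?V = "subst (\<lambda>i. var (Vvar i)) :: ('n, 'k) mpoly \<Rightarrow> ('n join_var, 'k) mpoly"
  let ?W = "subst (\<lambda>i. var (Wvar i)) :: ('n, 'k) mpoly \<Rightarrow> ('n join_var, 'k) mpoly"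
  let ?I = "ideal_gen (join_gens J K)"
  let ?h = "shift f"
  let ?D = "eval ?V (\<lambda>i. var (Wvar i)) ?h"
  let ?p = "\<lambda>\<alpha> t. pair (monom \<alpha> 1) (\<delta> t)"
  note hom_V = ring_homD[OF ring_hom_subst] and hom_sum = ring_hom_sum[OF ring_hom_subst]
  have D: "?D = (\<Sum>\<alpha>\<in>supp ?h. ?V (coef ?h \<alpha>) * ?W (monom \<alpha> 1))"
    by (subst eval_expand[OF ring_hom_subst ring_hom_const]) (simp add: subst_eq_eval)
  have "?D - (\<Sum>\<alpha>\<in>supp ?h. ?V (coef ?h \<alpha>) * ?W (\<Sum>t\<in>T. const (?p \<alpha> t) * e t)) =
      (\<Sum>\<alpha>\<in>supp ?h. ?V (coef ?h \<alpha>) * ?W (monom \<alpha> 1 - (\<Sum>t\<in>T. const (?p \<alpha> t) * e t)))"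
    unfolding D by (simp add: hom_V sum_subtractf right_diff_distrib)
  also have "\<dots> \<in> ?I"
    using K by (intro ideal.span_sum ideal.span_scale ideal.span_base) (auto simp: join_gens_def)
  finally have 1: "?D - (\<Sum>\<alpha>\<in>supp ?h. ?V (coef ?h \<alpha>) * ?W (\<Sum>t\<in>T. const (?p \<alpha> t) * e t)) \<in> ?I" .
  have "(\<Sum>\<alpha>\<in>supp ?h. ?V (coef ?h \<alpha>) * ?W (\<Sum>t\<in>T. const (?p \<alpha> t) * e t)) =
      (\<Sum>\<alpha>\<in>supp ?h. \<Sum>t\<in>T. ?V (coef ?h \<alpha> * const (?p \<alpha> t)) * ?W (e t))"
    by (simp add: hom_V hom_sum subst_const sum_distrib_left mult.assoc)
  also have "\<dots> = (\<Sum>t\<in>T. \<Sum>\<alpha>\<in>supp ?h. ?V (coef ?h \<alpha> * const (?p \<alpha> t)) * ?W (e t))"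
    by (rule sum.swap)
  also have "\<dots> = (\<Sum>t\<in>T. ?W (e t) * ?V (\<delta> t \<cdot> f))"
    by (simp add: contract_shift[symmetric] contract_eq_sum_pair hom_sum sum_distrib_left mult.commute)
  also have "\<dots> \<in> ?I"
    using J by (intro ideal.span_sum ideal.span_scale ideal.span_base) (auto simp: join_gens_def)
  finally have 2: "(\<Sum>\<alpha>\<in>supp ?h. ?V (coef ?h \<alpha>) * ?W (\<Sum>t\<in>T. const (?p \<alpha> t) * e t)) \<in> ?I" .
  have "?D \<in> ?I"
    using ideal.span_add[OF 1 2] unfolding diff_add_cancel .
  from ideal.span_add[OF subst_Xvar_cong[of f] this] have "subst (\<lambda>i. var (Xvar i)) f \<in> ?I"
    unfolding diff_add_cancel .
  then show ?thesis by (simp add: ideal_join_def join_gens_def)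
qed

section \<open>Finite dimensional spaces of operators\<close>

lemma pair_sum_left: "pair (\<Sum>x\<in>A. g x) \<delta> = (\<Sum>x\<in>A. pair (g x) \<delta>)"
  by (induction A rule: infinite_finite_induct) (auto simp: pair_add_left)

text \<open>Gram-Schmidt for the pairing: there is a projection $g \mapsto g - \sum_c \langle g,\delta_c\rangle e_c$
  onto the orthogonal complement of \<open>B\<close>. Indexing by \<open>B\<close> itself, even when \<open>B\<close> is linearly
  dependent, spares the choice of a basis.\<close>
lemma dual_family:
  fixes B :: "('n::finite, 'k::field) mpoly set"
  assumes "finite B"
  shows "\<exists>e \<delta>. (\<forall>b\<in>B. \<delta> b \<in> module.span smult B) \<and>
    (\<forall>g. \<forall>b\<in>B. pair (g - (\<Sum>c\<in>B. const (pair g (\<delta> c)) * e c)) b = 0)"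
  using assms
proof (induction B)
  case (insert b B)
  then obtain e \<delta> where \<delta>: "\<And>c. c \<in> B \<Longrightarrow> \<delta> c \<in> module.span smult B"
    and perp: "\<And>g c. c \<in> B \<Longrightarrow> pair (g - (\<Sum>c\<in>B. const (pair g (\<delta> c)) * e c)) c = 0"
    by blast
  define P where "P g = g - (\<Sum>c\<in>B. const (pair g (\<delta> c)) * e c)" for g
  \<comment> \<open>Moving the projection \<open>P\<close> from \<open>g\<close> to the other side of the pairing turns \<open>b\<close> into \<open>b'\<close>.\<close>
  define b' where "b' = b - (\<Sum>c\<in>B. smult (pair (e c) b) (\<delta> c))"
  have P: "pair (P g) b = pair g b'" for g
  proof -
    have "pair g b' = pair g b - (\<Sum>c\<in>B. pair g (\<delta> c) * pair (e c) b)"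
      unfolding b'_def pair_commute[of g]
      by (simp add: pair_diff_left pair_sum_left smult_def pair_const_mult_left)
        (simp add: mult.commute)
    then show ?thesis
      by (simp add: P_def pair_diff_left pair_sum_left pair_const_mult_left)
  qed
  \<comment> \<open>If \<open>b'\<close> pairs to 0 with everything, as for a linearly dependent \<open>b\<close>, then \<open>u = 0\<close> adds nothing
    to the projection.\<close>
  obtain u where u: "pair g b' * pair u b' = pair g b'" for g
  proof (cases "\<exists>v. pair v b' \<noteq> 0")
    case True
    then obtain v where "pair v b' \<noteq> 0" by blast
    then have "pair (const (1 / pair v b') * v) b' = 1"
      by (simp add: pair_const_mult_left)
    then show ?thesis using that by (metis mult.right_neutral)
  next
    case False
    then show ?thesis using that[of 0] by simp
  qed
  define e' where "e' = e(b := P u)"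
  define \<delta>' where "\<delta>' = \<delta>(b := b')"
  have sum: "g - (\<Sum>c\<in>insert b B. const (pair g (\<delta>' c)) * e' c) = P g - const (pair g b') * P u" for g
  proof -
    have "(\<Sum>c\<in>B. const (pair g (\<delta>' c)) * e' c) = (\<Sum>c\<in>B. const (pair g (\<delta> c)) * e c)"
      using insert(2) by (intro sum.cong) (auto simp: e'_def \<delta>'_def)
    then show ?thesis
      using insert(1,2) by (simp add: P_def) (simp add: e'_def \<delta>'_def P_def)
  qed
  have "pair (g - (\<Sum>c\<in>insert b B. const (pair g (\<delta>' c)) * e' c)) c = 0" if "c \<in> insert b B" for g c
    unfolding sum using that perp[folded P_def] P u by (auto simp: pair_diff_left pair_const_mult_left)
  moreover have "\<delta>' c \<in> module.span smult (insert b B)" if "c \<in> insert b B" for c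
  proof -
    have *: "\<delta> c \<in> module.span smult (insert b B)" if "c \<in> B" for c
      using \<delta>[OF that] poly_space.span_mono[of B "insert b B"] by blast
    then have "b' \<in> module.span smult (insert b B)"
      unfolding b'_def
      by (intro poly_space.span_diff poly_space.span_sum poly_space.span_scale) (auto intro: poly_space.span_base)
    then show ?thesis using * that by (auto simp: \<delta>'_def)
  qed
  ultimately show ?case by blast
qed simp

lemma bracket_eq_partial_deriv: "bracket \<delta> i = partial_deriv i \<delta>"
  unfolding bracket_def partial_deriv_def smult_def const_def
  by (simp add: mult_single mult.commute)

lemma bracket_closed_mono_deriv:
  fixes V :: "('n::finite, 'k::comm_ring_1) mpoly set"
  assumes "bracket_closed V" "F \<in> V"
  shows "mono_deriv \<alpha> F \<in> V"
proof (induction \<alpha> rule: exponent_induct)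
  case (add i \<beta>)
  then show ?case
    using assms(1) unfolding mono_deriv_step by (simp add: bracket_closed_def bracket_eq_partial_deriv)
qed (simp add: assms)

text \<open>Closure under the bracket, that is under derivatives, absorbs by adjointness the monomial multipliers
  that separate annihilation from orthogonality.\<close>
lemma mem_\<BB>_iff:
  fixes V :: "('n::finite, 'k::field_char_0) mpoly set"
  assumes "bracket_closed V"
  shows "g \<in> \<BB> V \<longleftrightarrow> (\<forall>F\<in>V. pair g F = 0)"
proof
  assume "g \<in> \<BB> V"
  then show "\<forall>F\<in>V. pair g F = 0"
    using action_eq_0_iff[of g] by (force simp: \<BB>_def perp_space_def dest: spec[of _ 0])
next
  assume "\<forall>F\<in>V. pair g F = 0"
  then show "g \<in> \<BB> V"
    using bracket_closed_mono_deriv[OF assms]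
    by (auto simp: \<BB>_def perp_space_def action_eq_0_iff pair_monom_mult)
qed

lemma finite_dim_projection:
  fixes V :: "('n::finite, 'k::field_char_0) mpoly set"
  assumes "finite_dim_subspace V" "bracket_closed V"
  obtains B :: "('n, 'k) mpoly set" and e \<delta> where "\<And>b. b \<in> B \<Longrightarrow> \<delta> b \<in> V"
    "\<And>g. g - (\<Sum>b\<in>B. const (pair g (\<delta> b)) * e b) \<in> \<BB> V"
proof -
  obtain B where B: "finite B" "V = module.span smult B"
    using assms(1) by (auto simp: finite_dim_subspace_def)
  obtain e \<delta> where \<delta>: "\<And>b. b \<in> B \<Longrightarrow> \<delta> b \<in> V"
    and perp: "\<And>g b. b \<in> B \<Longrightarrow> pair (g - (\<Sum>c\<in>B. const (pair g (\<delta> c)) * e c)) b = 0"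
    using dual_family[OF B(1)] B(2) by blast
  have proj: "g - (\<Sum>b\<in>B. const (pair g (\<delta> b)) * e b) \<in> \<BB> V" for g
    unfolding mem_\<BB>_iff[OF assms(2)]
  proof
    fix F assume "F \<in> V"
    then show "pair (g - (\<Sum>b\<in>B. const (pair g (\<delta> b)) * e b)) F = 0"
      unfolding B(2)
    proof (induction rule: poly_space.span_induct_alt)
      case base
      show ?case by (simp add: pair_def)
    next
      case (step c x y)
      then show ?case
        using perp[OF step(1), of g]
        by (simp add: pair_commute[of "_ - _"] pair_add_left smult_def pair_const_mult_left)
    qed
  qed
  show ?thesis by (rule that[OF \<delta> proj])
qed

section \<open>Operators orthogonal to a primary ideal\<close>

lemma max_primary_powers:
  fixes M :: "('n::finite, 'k::comm_ring_1) mpoly set"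
  assumes "max_primary M"
  obtains N where "\<And>\<alpha> i. N \<le> coef \<alpha> i \<Longrightarrow> monom \<alpha> 1 \<in> M"
proof -
  have M: "is_ideal M" and rad: "radical M = max_ideal"
    using assms by (auto simp: max_primary_def primary_ideal_def)
  have "\<exists>k. var i ^ k \<in> M" for i
  proof -
    have "var i \<in> radical M" unfolding rad max_ideal_def by (auto intro: ideal.span_base)
    then show ?thesis by (simp add: radical_def)
  qed
  then obtain k where k: "\<And>i. var i ^ k i \<in> M" by metis
  have pow: "(var i :: ('n, 'k) mpoly) ^ m = monom (monom i m) 1" for i m
  proof (induction m)
    case (Suc m)
    then show ?case by (simp add: var_def mult_single single_add[symmetric])
  qed simp
  have "monom \<alpha> 1 \<in> M" if "Max (range k) \<le> coef \<alpha> i" for \<alpha> i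
  proof -
    have "k i \<le> coef \<alpha> i"
      using that by (meson Max_ge finite finite_imageI order_trans rangeI)
    then have "(\<alpha> - monom i (k i)) + monom i (k i) = \<alpha>"
      by (auto intro!: poly_mapping_eqI simp: lookup_add lookup_minus lookup_single when_def)
    then have "monom \<alpha> (1 :: 'k) = monom (\<alpha> - monom i (k i)) 1 * var i ^ k i"
      by (simp add: pow mult_single)
    then show ?thesis using ideal_mult[OF M k] by simp
  qed
  then show ?thesis by (rule that)
qed

lemma finite_exponent_box: "finite {\<alpha> :: 'n::finite \<Rightarrow>\<^sub>0 nat. \<forall>i. coef \<alpha> i < N}"
proof (rule finite_imageD)
  show "finite (coef ` {\<alpha> :: 'n \<Rightarrow>\<^sub>0 nat. \<forall>i. coef \<alpha> i < N})"
    by (rule finite_subset[OF _ finite_set_of_finite_funs[of "UNIV :: 'n set" "{..<N}" 0]]) auto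
  show "inj_on coef {\<alpha> :: 'n \<Rightarrow>\<^sub>0 nat. \<forall>i. coef \<alpha> i < N}"
    by (auto intro!: inj_onI poly_mapping_eqI)
qed

text \<open>The quotient of $R$ by $M$ is finite dimensional, because monomials outside of a box of exponents lie
  in $M$. Extending a basis of $M$ to one of $R$ by monomials \<open>c\<close> from the box gives coordinate
  functionals that vanish on $M$. Such a functional sees only finitely many monomials, so it is the
  pairing with some $\delta_c$; dividing by $\alpha!$ uses characteristic zero.\<close>
lemma max_primary_projection:
  fixes M :: "('n::finite, 'k::field_char_0) mpoly set"
  assumes "max_primary M"
  obtains C \<delta> where "\<And>c. c \<in> C \<Longrightarrow> \<delta> c \<in> \<AA> M"
    "\<And>g. g - (\<Sum>c\<in>C. const (pair g (\<delta> c)) * c) \<in> M"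
proof -
  have M: "is_ideal M"
    using assms by (auto simp: max_primary_def primary_ideal_def)
  have sub_M: "poly_space.subspace M"
    using M by (auto simp: poly_space.subspace_def ideal.subspace_def smult_def)
  obtain N where N: "\<And>\<alpha> i. N \<le> coef \<alpha> i \<Longrightarrow> monom \<alpha> 1 \<in> M"
    using max_primary_powers[OF assms] by blast
  define box where "box = {\<alpha> :: 'n \<Rightarrow>\<^sub>0 nat. \<forall>i. coef \<alpha> i < N}"
  have fin_box: "finite box" unfolding box_def by (rule finite_exponent_box)
  have outside: "monom \<alpha> 1 \<in> M" if "\<alpha> \<notin> box" for \<alpha>
    using that N by (auto simp: box_def not_less)
  obtain S where S: "S \<subseteq> M" "poly_space.independent S" "M \<subseteq> poly_space.span S"
    using poly_space.maximal_independent_subset by blast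
  have span_S: "poly_space.span S = M"
    using S sub_M by (metis poly_space.span_minimal subset_antisym)
  obtain B where B: "S \<subseteq> B" "B \<subseteq> S \<union> (\<lambda>\<alpha>. monom \<alpha> 1) ` box" "poly_space.independent B"
    "S \<union> (\<lambda>\<alpha>. monom \<alpha> 1) ` box \<subseteq> poly_space.span B"
    using poly_space.maximal_independent_subset_extend[of S "S \<union> (\<lambda>\<alpha>. monom \<alpha> 1) ` box"] S(2) by blast
  have M_B: "M \<subseteq> poly_space.span B"
    using poly_space.span_mono[OF B(1)] span_S by simp
  have span_B: "f \<in> poly_space.span B" for f
  proof (induction f rule: monomial_induct)
    case (single \<alpha> c)
    have "monom \<alpha> 1 \<in> poly_space.span B"
      using B(4) M_B outside by (cases "\<alpha> \<in> box") auto
    then have "smult c (monom \<alpha> 1) \<in> poly_space.span B"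
      by (rule poly_space.span_scale)
    moreover have "smult c (monom \<alpha> 1) = monom \<alpha> c"
      by (simp add: smult_def const_def mult_single)
    ultimately show ?case by simp
  qed (rule poly_space.span_add)
  define C where "C = B - S"
  have fin_C: "finite C"
    using B(2) fin_box by (auto simp: C_def intro: finite_subset)
  define coord where "coord c g = poly_space.representation B g c" for c g
  have coord_add: "coord c (f + g) = coord c f + coord c g" for c f g
    by (simp add: coord_def poly_space.representation_add[OF B(3) span_B span_B])
  have coord_const: "coord c (const a * g) = a * coord c g" for c a g
    using poly_space.representation_scale[OF B(3) span_B, of a g] by (simp add: coord_def smult_def)
  have coord_M: "coord c f = 0" if "c \<in> C" "f \<in> M" for c f
  proof -
    have "coord c f = poly_space.representation S f c"
      unfolding coord_def
      by (subst poly_space.representation_extend[OF B(3) _ B(1)]) (simp_all add: that span_S)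
    then show ?thesis
      using that poly_space.representation_ne_zero[of S f c] by (auto simp: C_def)
  qed
  define \<delta> where "\<delta> c = (\<Sum>\<alpha>\<in>box. monom \<alpha> (coord c (monom \<alpha> 1) / of_nat (exp_fact \<alpha>)))" for c
  have coef_\<delta>: "coef (\<delta> c) \<alpha> = (if \<alpha> \<in> box then coord c (monom \<alpha> 1) / of_nat (exp_fact \<alpha>) else 0)" for c \<alpha>
    unfolding \<delta>_def lookup_sum using fin_box by (simp add: lookup_single when_def)
  have pair_\<delta>: "pair g (\<delta> c) = coord c g" if "c \<in> C" for c g
  proof (induction g rule: monomial_induct)
    case (single \<alpha> a)
    have "coord c (monom \<alpha> a) = a * coord c (monom \<alpha> 1)"
      using coord_const[of c a "monom \<alpha> 1"] by (simp add: const_def mult_single)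
    moreover have "coord c (monom \<alpha> 1) = 0" if "\<alpha> \<notin> box"
      using coord_M[OF \<open>c \<in> C\<close>] outside that by simp
    ultimately show ?case by (simp add: pair_monom coef_\<delta>)
  qed (simp add: pair_add_left coord_add)
  have "\<delta> c \<in> \<AA> M" if "c \<in> C" for c
    using that coord_M ideal_mult[OF M] by (simp add: \<AA>_def perp_ideal_def action_eq_0_iff pair_\<delta>)
  moreover have "g - (\<Sum>c\<in>C. const (pair g (\<delta> c)) * c) \<in> M" for g
  proof -
    define U where "U = {b. poly_space.representation B g b \<noteq> 0} \<union> C"
    have U: "finite U" "U \<subseteq> B" "C \<subseteq> U"
      using fin_C poly_space.finite_representation poly_space.representation_ne_zero[of B g]
      by (auto simp: U_def C_def)
    have "g = (\<Sum>b | poly_space.representation B g b \<noteq> 0. smult (coord b g) b)"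
      unfolding coord_def by (rule poly_space.sum_nonzero_representation_eq[OF B(3) span_B, symmetric])
    also have "\<dots> = (\<Sum>b\<in>U. smult (coord b g) b)"
      using U(1) by (intro sum.mono_neutral_left) (auto simp: U_def coord_def)
    also have "\<dots> = (\<Sum>b\<in>U - C. smult (coord b g) b) + (\<Sum>b\<in>C. smult (coord b g) b)"
      by (rule sum.subset_diff[OF U(3,1)])
    finally have "g - (\<Sum>b\<in>C. smult (coord b g) b) = (\<Sum>b\<in>U - C. smult (coord b g) b)"
      by (simp add: algebra_simps)
    also have "\<dots> \<in> M"
      using U(2) S(1) by (intro poly_space.subspace_sum[OF sub_M] poly_space.subspace_scale[OF sub_M])
        (auto simp: C_def)
    finally show ?thesis by (simp add: pair_\<delta> smult_def)
  qed
  ultimately show ?thesis by (rule that[where C = C and \<delta> = \<delta>])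
qed

text \<open>In both parts one inclusion is the contraction argument \<open>action_mem_of_mem_join\<close>; the other feeds the
  projection onto the second ideal into \<open>mem_join_of_action_mem\<close>.\<close>
theorem theorem5p3:
  fixes J :: "('n::finite, 'k::field_char_0) mpoly set"
  assumes "is_ideal J"
  shows "(\<forall>M :: ('n, 'k) mpoly set. max_primary M \<longrightarrow>
            J \<star> M = {f. \<forall>\<delta>\<in>\<AA> M. \<delta> \<cdot> f \<in> J})
       \<and> (\<forall>V :: ('n, 'k) mpoly set. finite_dim_subspace V \<and> bracket_closed V \<longrightarrow>
            {f. \<forall>\<delta>\<in>V. \<delta> \<cdot> f \<in> J} = J \<star> \<BB> V)"
proof (intro conjI allI impI)
  fix M :: "('n, 'k) mpoly set"
  assume M: "max_primary M"
  show "J \<star> M = {f. \<forall>\<delta>\<in>\<AA> M. \<delta> \<cdot> f \<in> J}"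
  proof (intro equalityI subsetI)
    fix f assume "f \<in> J \<star> M"
    then show "f \<in> {f. \<forall>\<delta>\<in>\<AA> M. \<delta> \<cdot> f \<in> J}"
      using action_mem_of_mem_join[OF assms, of M] by (auto simp: \<AA>_def perp_ideal_def)
  next
    fix f assume f: "f \<in> {f. \<forall>\<delta>\<in>\<AA> M. \<delta> \<cdot> f \<in> J}"
    show "f \<in> J \<star> M"
    proof (rule max_primary_projection[OF M])
      fix C :: "('n, 'k) mpoly set" and \<delta>
      assume "\<And>c. c \<in> C \<Longrightarrow> \<delta> c \<in> \<AA> M" "\<And>g. g - (\<Sum>c\<in>C. const (pair g (\<delta> c)) * c) \<in> M"
      then show ?thesis
        using f by (intro mem_join_of_action_mem[where T = C and \<delta> = \<delta> and e = "\<lambda>c. c"]) auto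
    qed
  qed
next
  fix V :: "('n, 'k) mpoly set"
  assume V: "finite_dim_subspace V \<and> bracket_closed V"
  show "{f. \<forall>\<delta>\<in>V. \<delta> \<cdot> f \<in> J} = J \<star> \<BB> V"
  proof (intro equalityI subsetI)
    fix f assume f: "f \<in> {f. \<forall>\<delta>\<in>V. \<delta> \<cdot> f \<in> J}"
    show "f \<in> J \<star> \<BB> V"
    proof (rule finite_dim_projection[OF conjunct1[OF V] conjunct2[OF V]])
      fix B :: "('n, 'k) mpoly set" and e \<delta>
      assume "\<And>b. b \<in> B \<Longrightarrow> \<delta> b \<in> V" "\<And>g. g - (\<Sum>b\<in>B. const (pair g (\<delta> b)) * e b) \<in> \<BB> V"
      then show ?thesis
        using f by (intro mem_join_of_action_mem[where T = B and \<delta> = \<delta> and e = e]) auto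
    qed
  next
    fix f assume "f \<in> J \<star> \<BB> V"
    then show "f \<in> {f. \<forall>\<delta>\<in>V. \<delta> \<cdot> f \<in> J}"
      using action_mem_of_mem_join[OF assms, of "\<BB> V"] by (auto simp: \<BB>_def perp_space_def)
  qed
qed

end
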